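(* Let $G$ be a regular complete multipartite graph. Then, for every $S \subseteq V(G)$, $\mathcal{E}(G_S)\geq \mathcal{E}(G)$.
   Context: The complete multipartite graph $K_{n_1,\ldots,n_k}$ is the complement of the disjoint union $K_{n_1}\,\dot\cup\cdots\dot\cup\,K_{n_k}$ of complete graphs; it is regular when all vertices have the same degree. For a simple graph $G$ of order $n$ and $S\subseteq V(G)$ with $|S|=\sigma$, the self-loop graph $G_S$ is obtained from $G$ by attaching one loop at each vertex of $S$; its adjacency matrix is $A(G_S)=A(G)+\mathfrak{I}_S$, where $\mathfrak{I}_S$ is the diagonal $0/1$ matrix with ones exactly at the positions corresponding to $S$. With $\lambda_1(G_S)\ge\cdots\ge\lambda_n(G_S)$ the eigenvalues of $A(G_S)$, the energy is $\mathcal{E}(G_S)=\sum_{i=1}^n\left|\lambda_i(G_S)-\frac{\sigma}{n}\right|$; in particular $\mathcal{E}(G)=\sum_{i=1}^n|\lambda_i(G)|$. *)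

theory Defs
  imports
    "Graph_Theory.Kuratowski"
    "Graph_Theory.Digraph_Isomorphism"
    "Jordan_Normal_Form.Char_Poly"
    "HOL-Computational_Algebra.Fundamental_Theorem_Algebra"
begin

text \<open>
  Finite simple graphs are the symmetric, loop-free, finite pair digraphs of the locale
  \<^locale>\<open>pair_graph\<close>: an edge uv is the pair of arcs (u,v) and (v,u).
\<close>

subsection \<open>Complete multipartite graphs\<close>

definition complete_graph :: "nat \<Rightarrow> nat pair_pre_digraph" where
  "complete_graph n = \<lparr> pverts = {..<n}, parcs = {(u, v). u < n \<and> v < n \<and> u \<noteq> v} \<rparr>"

definition complement_graph :: "'a pair_pre_digraph \<Rightarrow> 'a pair_pre_digraph" where
  "complement_graph G = \<lparr> pverts = pverts G,
     parcs = {(u, v). u \<in> pverts G \<and> v \<in> pverts G \<and> u \<noteq> v \<and> (u, v) \<notin> parcs G} \<rparr>"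

text \<open>Disjointness is enforced by tagging each vertex with the index of its summand.\<close>

definition disjoint_union_graph ::
    "'a pair_pre_digraph list \<Rightarrow> (nat \<times> 'a) pair_pre_digraph" where
  "disjoint_union_graph Gs =
     \<lparr> pverts = {(i, u). i < length Gs \<and> u \<in> pverts (Gs ! i)},
       parcs = {((i, u), (j, v)). i = j \<and> i < length Gs \<and> (u, v) \<in> parcs (Gs ! i)} \<rparr>"

definition complete_multipartite_graph :: "nat list \<Rightarrow> (nat \<times> nat) pair_pre_digraph" where
  "complete_multipartite_graph ns =
     complement_graph (disjoint_union_graph (map complete_graph ns))"

definition complete_multipartite :: "'a pair_pre_digraph \<Rightarrow> bool" where
  "complete_multipartite G \<longleftrightarrow>
     (\<exists>ns. ns \<noteq> [] \<and> (\<forall>m \<in> set ns. 0 < m) \<and>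
        digraph_iso (with_proj G) (with_proj (complete_multipartite_graph ns)))"

text \<open>In a symmetric loop-free digraph the out-degree of a vertex is its number of neighbours.\<close>

definition regular_graph :: "'a pair_pre_digraph \<Rightarrow> bool" where
  "regular_graph G \<longleftrightarrow> (\<exists>d. \<forall>v \<in> pverts G. out_degree (with_proj G) v = d)"

lemma complete_graph_complete_digraph: "K\<^bsub>n\<^esub> (with_proj (complete_graph n))"
  by (auto simp: complete_digraph_pair_def complete_graph_def)

lemma complete_multipartite_graph_simps:
  "pverts (complete_multipartite_graph ns) = {(i, u). i < length ns \<and> u < ns ! i}"
  "parcs (complete_multipartite_graph ns) =
     {((i, u), (j, v)). i < length ns \<and> u < ns ! i \<and> j < length ns \<and> v < ns ! j \<and> i \<noteq> j}"
  by (auto simp: complete_multipartite_graph_def complement_graph_def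
      disjoint_union_graph_def complete_graph_def)

subsection \<open>Adjacency matrices and energy\<close>

text \<open>
  Matrices are indexed by {0..<n}, so a numbering \<open>vs\<close> of the vertices is needed; the
  spectrum does not depend on it (see \<open>eigvals_adjacency_mat\<close> below).
\<close>

definition adj_mat_wrt :: "'a list \<Rightarrow> 'a pair_pre_digraph \<Rightarrow> real mat" where
  "adj_mat_wrt vs G = mat (length vs) (length vs)
     (\<lambda>(i, j). if (vs ! i, vs ! j) \<in> parcs G then 1 else 0)"

definition loop_mat_wrt :: "'a list \<Rightarrow> 'a set \<Rightarrow> real mat" where
  "loop_mat_wrt vs S = mat (length vs) (length vs)
     (\<lambda>(i, j). if i = j \<and> vs ! i \<in> S then 1 else 0)"

definition vertex_list :: "'a pair_pre_digraph \<Rightarrow> 'a list" where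
  "vertex_list G = (SOME vs. distinct vs \<and> set vs = pverts G)"

definition adjacency_mat :: "'a pair_pre_digraph \<Rightarrow> real mat" where
  "adjacency_mat G = adj_mat_wrt (vertex_list G) G"

definition self_loop_adjacency_mat :: "'a pair_pre_digraph \<Rightarrow> 'a set \<Rightarrow> real mat" where
  "self_loop_adjacency_mat G S = adjacency_mat G + loop_mat_wrt (vertex_list G) S"

text \<open>
  The real eigenvalues with algebraic multiplicity. For a symmetric matrix these are all the
  eigenvalues (\<open>size_eigvals_symmetric\<close>).
\<close>

definition eigvals :: "real mat \<Rightarrow> real multiset" where
  "eigvals A = proots (char_poly A)"

definition energy :: "'a pair_pre_digraph \<Rightarrow> real" where
  "energy G = (\<Sum>l \<in># eigvals (adjacency_mat G). \<bar>l\<bar>)"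

definition self_loop_energy :: "'a pair_pre_digraph \<Rightarrow> 'a set \<Rightarrow> real" where
  "self_loop_energy G S =
     (\<Sum>l \<in># eigvals (self_loop_adjacency_mat G S).
        \<bar>l - real (card S) / real (card (pverts G))\<bar>)"

lemma self_loop_energy_empty: "self_loop_energy G {} = energy G"
proof -
  have "loop_mat_wrt (vertex_list G) {} =
      0\<^sub>m (length (vertex_list G)) (length (vertex_list G))"
    by (auto simp: loop_mat_wrt_def)
  then have "self_loop_adjacency_mat G {} = adjacency_mat G"
    by (auto simp: self_loop_adjacency_mat_def adjacency_mat_def adj_mat_wrt_def)
  then show ?thesis by (simp add: self_loop_energy_def energy_def)
qed

subsection \<open>Well-definedness\<close>

lemma vertex_list:
  assumes "finite (pverts G)"
  shows "distinct (vertex_list G)" "set (vertex_list G) = pverts G"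
proof -
  have "\<exists>vs. distinct vs \<and> set vs = pverts G"
    using finite_distinct_list[OF assms] by blast
  from someI_ex[OF this]
  show "distinct (vertex_list G)" "set (vertex_list G) = pverts G"
    by (simp_all add: vertex_list_def)
qed

lemma char_poly_reindex:
  fixes A :: "real mat"
  assumes A: "A \<in> carrier_mat n n" and f: "f permutes {..<n}"
  shows "char_poly (mat n n (\<lambda>(i, j). A $$ (f i, f j))) = char_poly A"
proof (rule char_poly_similar, rule similar_matI)
  let ?B = "mat n n (\<lambda>(i, j). A $$ (f i, f j))"
  let ?P = "mat n n (\<lambda>(i, j). if j = f i then 1 else 0) :: real mat"
  let ?Q = "mat n n (\<lambda>(i, j). if i = f j then 1 else 0) :: real mat"
  have fn: "f i < n" if "i < n" for i using permutes_in_image[OF f, of i] that by simp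
  have inj: "f i = f j \<longleftrightarrow> i = j" for i j using permutes_inj[OF f] by (simp add: inj_eq)
  show "{?B, A, ?P, ?Q} \<subseteq> carrier_mat n n" using A by auto
  have d1: "(if b then 1 else 0) * x = (if b then x else 0)"
    and d2: "x * (if b then 1 else 0) = (if b then x else 0)" for b and x :: real
    by simp_all
  have PQ: "?P * ?Q = 1\<^sub>m n"
    by (rule eq_matI) (simp_all add: scalar_prod_def d1 fn inj)
  show "?P * ?Q = 1\<^sub>m n" by (fact PQ)
  show "?Q * ?P = 1\<^sub>m n"
    by (rule mat_mult_left_right_inverse[OF _ _ PQ]) simp_all
  have PA: "?P * A = mat n n (\<lambda>(i, j). A $$ (f i, j))"
    using A by (intro eq_matI) (simp_all add: scalar_prod_def d1 fn)
  show "?B = ?P * A * ?Q"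
    unfolding PA by (rule eq_matI) (simp_all add: scalar_prod_def d2 fn)
qed

lemma eigvals_adjacency_mat:
  assumes fin: "finite (pverts G)" and vs: "distinct vs" "set vs = pverts G"
  shows "eigvals (self_loop_adjacency_mat G S) = eigvals (adj_mat_wrt vs G + loop_mat_wrt vs S)"
    and "eigvals (adjacency_mat G) = eigvals (adj_mat_wrt vs G)"
proof -
  define ws where "ws = vertex_list G"
  have ws: "distinct ws" "set ws = pverts G" using vertex_list[OF fin] by (simp_all add: ws_def)
  define n where "n = length vs"
  have n: "length ws = n" using vs ws distinct_card by (metis n_def)
  have "mset ws = mset vs" using vs ws by (simp add: set_eq_iff_mset_eq_distinct[symmetric])
  then obtain f where f: "f permutes {..<length vs}" "permute_list f vs = ws"
    by (rule mset_eq_permutation)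
  have fn: "f i < n" if "i < n" for i
    using permutes_in_image[OF f(1), of i] that by (simp add: n_def)
  have inj: "f i = f j \<longleftrightarrow> i = j" for i j using permutes_inj[OF f(1)] by (simp add: inj_eq)
  have nth: "ws ! i = vs ! f i" if "i < n" for i
    using f that permute_list_nth[OF f(1)] by (auto simp: n_def)
  have "adj_mat_wrt ws G + loop_mat_wrt ws S =
      mat n n (\<lambda>(i, j). (adj_mat_wrt vs G + loop_mat_wrt vs S) $$ (f i, f j))"
    by (rule eq_matI)
      (auto simp: adj_mat_wrt_def loop_mat_wrt_def n nth fn inj n_def[symmetric])
  moreover have "adj_mat_wrt ws G = mat n n (\<lambda>(i, j). adj_mat_wrt vs G $$ (f i, f j))"
    by (rule eq_matI)
      (auto simp: adj_mat_wrt_def n nth fn inj n_def[symmetric])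
  moreover have "adj_mat_wrt vs G + loop_mat_wrt vs S \<in> carrier_mat n n"
      "adj_mat_wrt vs G \<in> carrier_mat n n"
    by (simp_all add: adj_mat_wrt_def loop_mat_wrt_def n_def)
  ultimately show
      "eigvals (self_loop_adjacency_mat G S) = eigvals (adj_mat_wrt vs G + loop_mat_wrt vs S)"
      "eigvals (adjacency_mat G) = eigvals (adj_mat_wrt vs G)"
    using f(1) by (simp_all add: eigvals_def self_loop_adjacency_mat_def adjacency_mat_def
        ws_def[symmetric] char_poly_reindex n_def[symmetric])
qed

lemma symmetric_complex_eigenvalue_real:
  fixes A :: "real mat"
  assumes A: "A \<in> carrier_mat n n" and sym: "transpose_mat A = A"
    and ev: "eigenvalue (map_mat complex_of_real A) c"
  shows "Im c = 0"
proof -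
  let ?A = "map_mat complex_of_real A"
  from ev obtain v where v: "v \<in> carrier_vec n" "v \<noteq> 0\<^sub>v n" "?A *\<^sub>v v = c \<cdot>\<^sub>v v"
    using A by (auto simp: eigenvalue_def eigenvector_def)
  have Aij: "A $$ (i, j) = A $$ (j, i)" if "i < n" "j < n" for i j
    using A that sym index_transpose_mat(1)[of j A i] by auto
  have row: "(\<Sum>j<n. of_real (A $$ (i, j)) * v $ j) = c * v $ i" if "i < n" for i
  proof -
    have "(?A *\<^sub>v v) $ i = (\<Sum>j<n. of_real (A $$ (i, j)) * v $ j)"
      using A v(1) that by (auto simp: scalar_prod_def lessThan_atLeast0 intro!: sum.cong)
    then show ?thesis using v that by auto
  qed
  define N where "N = (\<Sum>i<n. (cmod (v $ i))\<^sup>2)"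
  define T where "T = (\<Sum>i<n. \<Sum>j<n. of_real (A $$ (i, j)) * v $ j * cnj (v $ i))"
  have "T = (\<Sum>i<n. c * v $ i * cnj (v $ i))"
    unfolding T_def by (intro sum.cong refl) (simp add: row[symmetric] sum_distrib_right)
  also have "\<dots> = c * of_real N"
    by (simp add: N_def sum_distrib_left mult.assoc complex_norm_square[symmetric] flip: of_real_power)
  finally have T: "T = c * of_real N" .
  have "cnj T = (\<Sum>i<n. \<Sum>j<n. of_real (A $$ (i, j)) * cnj (v $ j) * v $ i)"
    by (simp add: T_def)
  also have "\<dots> = (\<Sum>j<n. \<Sum>i<n. of_real (A $$ (i, j)) * cnj (v $ j) * v $ i)"
    by (rule sum.swap)
  also have "\<dots> = T"
    unfolding T_def by (intro sum.cong refl) (auto simp: Aij mult_ac)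
  finally have "cnj c * of_real N = c * of_real N" using T by simp
  moreover have "N \<noteq> 0"
  proof
    assume "N = 0"
    then have "\<forall>i<n. v $ i = 0" by (simp add: N_def sum_nonneg_eq_0_iff)
    with v(1,2) show False by auto
  qed
  ultimately have "cnj c = c" by simp
  then show ?thesis by (simp add: complex_eq_iff)
qed

lemma proots_linear_factors:
  "proots (\<Prod>a\<leftarrow>xs. [:- a, 1:]) = mset (xs :: real list)"
proof (induction xs)
  case (Cons x xs)
  have "(\<Prod>a\<leftarrow>xs. [:- a, 1:]) \<noteq> 0" by (auto simp: prod_list_zero_iff)
  then have "proots ([:- x, 1:] * (\<Prod>a\<leftarrow>xs. [:- a, 1:])) =
      proots [:- x, 1:] + proots (\<Prod>a\<leftarrow>xs. [:- a, 1:])"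
    by (intro proots_mult) auto
  with Cons.IH show ?case by (simp del: mult_pCons_left)
qed simp

lemma size_eigvals_symmetric:
  assumes A: "A \<in> carrier_mat n n" and sym: "transpose_mat A = A"
  shows "size (eigvals A) = n"
proof -
  interpret h: map_poly_inj_idom_hom complex_of_real ..
  let ?A = "map_mat complex_of_real A"
  have cA: "?A \<in> carrier_mat n n" using A by simp
  from char_poly_factorized[OF cA] obtain as
    where as: "char_poly ?A = (\<Prod>a\<leftarrow>as. [:- a, 1:])" and len: "length as = n"
    by blast
  have "Im a = 0" if "a \<in> set as" for a
  proof -
    have "poly (char_poly ?A) a = 0"
      unfolding as using that by (auto simp: poly_prod_list_zero_iff)
    then have "eigenvalue ?A a" using eigenvalue_root_char_poly[OF cA] by simp
    then show ?thesis by (rule symmetric_complex_eigenvalue_real[OF A sym])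
  qed
  then have re: "map complex_of_real (map Re as) = as"
    by (auto simp: complex_eq_iff intro!: map_idI)
  have "map_poly complex_of_real (char_poly A) = char_poly ?A"
    by (simp add: of_real_hom.char_poly_hom[OF A])
  also have "\<dots> = (\<Prod>a\<leftarrow>map complex_of_real (map Re as). [:- a, 1:])"
    unfolding re by (fact as)
  also have "\<dots> = map_poly complex_of_real (\<Prod>a\<leftarrow>map Re as. [:- a, 1:])"
    unfolding h.hom_prod_list map_map o_def by (simp del: h.prod_list_map_hom)
  finally have "char_poly A = (\<Prod>a\<leftarrow>map Re as. [:- a, 1:])"
    by (rule h.injectivity)
  then have "eigvals A = mset (map Re as)"
    unfolding eigvals_def by (simp only: proots_linear_factors)
  then show ?thesis using len by simp
qed

lemma (in pair_graph) size_eigvals_self_loop_adjacency_mat: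
  "size (eigvals (self_loop_adjacency_mat G S)) = card (pverts G)"
proof (rule size_eigvals_symmetric)
  have len: "length (vertex_list G) = card (pverts G)"
    using vertex_list[OF pair_finite_verts] distinct_card by metis
  show "self_loop_adjacency_mat G S \<in> carrier_mat (card (pverts G)) (card (pverts G))"
    by (simp add: self_loop_adjacency_mat_def adjacency_mat_def adj_mat_wrt_def
        loop_mat_wrt_def len)
  show "transpose_mat (self_loop_adjacency_mat G S) = self_loop_adjacency_mat G S"
    by (rule eq_matI) (auto simp: self_loop_adjacency_mat_def adjacency_mat_def adj_mat_wrt_def
        loop_mat_wrt_def dest: arcs_symmetric)
qed

end

theory Submission
  imports Defs
begin

text \<open>
  Let \<open>G\<close> have \<open>n\<close> vertices and classes of size \<open>m\<close>, let \<open>J\<close> be the all-ones matrix and let \<open>P\<close> be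
  the orthogonal projection onto the vectors that are constant on classes and have sum zero. Then
  \<open>A(G) = ((n - m)/n) J - m P\<close>, and bounding the eigenvalues in an orthonormal eigenbasis by the
  quadratic form of \<open>|A(G)| = ((n - m)/n) J + m P\<close> gives \<open>E(G) \<le> tr |A(G)| = 2(n - m)\<close>.
  Conversely, \<open>\<Sum>|\<mu>\<^sub>j| \<ge> tr (B C)\<close> whenever the \<open>\<mu>\<^sub>j\<close> are the eigenvalues of a symmetric matrix \<open>B\<close>
  and the quadratic form of \<open>C\<close> is bounded by the squared norm. Take \<open>C = I - 2P\<close> and
  \<open>B = A(G) + I\<^sub>S - (\<sigma>/n) I\<close>: as \<open>C\<close> has constant diagonal and \<open>I\<^sub>S - (\<sigma>/n) I\<close> is a diagonal matrix of
  trace zero, the loops cancel and \<open>tr (B C) = tr (A(G) C) = 2(n - m)\<close>.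
\<close>

section \<open>Orthogonal diagonalization of real symmetric matrices\<close>

text \<open>The reflection is \<open>I - c u u\<^sup>T\<close> with \<open>u = v - e\<^sub>0\<close>; for \<open>u = 0\<close> the junk value
  \<open>c = 2 / 0 = 0\<close> correctly makes it the identity.\<close>

lemma householder_unit_vec:
  fixes v :: "real vec"
  assumes v: "v \<in> carrier_vec n" "v \<bullet> v = 1" and n: "0 < n"
  obtains H where "H \<in> carrier_mat n n" "transpose_mat H = H" "H * H = 1\<^sub>m n" "col H 0 = v"
proof -
  define u where "u i = v $ i - (if i = 0 then 1 else 0)" for i
  define s where "s = (\<Sum>i<n. u i * u i)"
  define c where "c = 2 / s"
  define H where "H = mat n n (\<lambda>(i, j). (if i = j then 1 else 0) - c * u i * u j)"
  have vv: "(\<Sum>i<n. v $ i * v $ i) = 1"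
    using v by (simp add: scalar_prod_def lessThan_atLeast0)
  have "s = (\<Sum>i<n. v $ i * v $ i - (if i = 0 then 2 * v $ 0 - 1 else 0))"
    unfolding s_def by (intro sum.cong) (auto simp: u_def algebra_simps)
  also have "\<dots> = 2 - 2 * v $ 0"
    using n by (simp add: sum_subtractf vv)
  finally have s: "s = - 2 * u 0" by (simp add: u_def)
  have u0: "u i = 0" if "s = 0" "i < n" for i
    using that unfolding s_def by (subst (asm) sum_nonneg_eq_0_iff) auto
  \<comment> \<open>Column 0 of \<open>H\<close> is e_0 - (c u_0) u, so this identity turns it into
    e_0 + u = v. It rests on |u|^2 = 2 - 2 v_0 = -2 u_0, which uses |v| = 1.\<close>
  have cu: "c * u 0 * u i = - u i" if "i < n" for i
  proof (cases "s = 0")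
    case True
    then show ?thesis using u0 that by simp
  next
    case False
    then have "c * u 0 = - 1" by (simp add: c_def s field_simps)
    then show ?thesis by simp
  qed
  \<comment> \<open>This cancels the quadratic term of (I - c u u^T)^2 against the linear one; for s
    = 0 both sides are 0.\<close>
  have ccs: "c * c * s = 2 * c" by (simp add: c_def)
  have "(\<Sum>k<n. ((if i = k then 1 else 0) - c * u i * u k) * ((if k = j then 1 else 0) - c * u k * u j))
      = (if i = j then 1 else 0)" if ij: "i < n" "j < n" for i j
  proof -
    have "(\<Sum>k<n. ((if i = k then 1 else 0) - c * u i * u k) * ((if k = j then 1 else 0) - c * u k * u j))
      = (\<Sum>k<n. (if k = i then (if i = j then 1 else 0) - c * u i * u j else 0)
          - (if k = j then c * u i * u j else 0) + c * c * u i * u j * (u k * u k))"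
      by (intro sum.cong) (auto simp: algebra_simps)
    also have "\<dots> = (if i = j then 1 else 0) - 2 * c * u i * u j + (c * c * s) * u i * u j"
      using ij by (simp add: sum.distrib sum_subtractf sum_distrib_left[symmetric] s_def[symmetric])
    finally show ?thesis by (simp add: ccs)
  qed
  then have "H * H = 1\<^sub>m n"
    by (intro eq_matI) (auto simp: H_def scalar_prod_def lessThan_atLeast0)
  moreover have "col H 0 = v"
  proof (rule eq_vecI)
    fix i assume i: "i < dim_vec v"
    then have "i < n" using v by simp
    then have "col H 0 $ i = (if i = 0 then 1 else 0) - c * u 0 * u i"
      using n by (simp add: H_def mult_ac)
    also have "\<dots> = v $ i"
      unfolding cu[OF \<open>i < n\<close>] by (simp add: u_def)
    finally show "col H 0 $ i = v $ i" .
  qed (use v in \<open>simp add: H_def\<close>)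
  ultimately show thesis
    by (intro that[of H]) (auto simp: H_def)
qed

text \<open>A real eigenvalue exists because the multiset \<open>eigvals A\<close> has n > 0
  elements. Scaling an eigenvector by the inverse of its length makes it a unit vector.\<close>

lemma symmetric_eigenvector_exists:
  fixes A :: "real mat"
  assumes A: "A \<in> carrier_mat n n" and sym: "transpose_mat A = A" and n: "0 < n"
  obtains v c where "v \<in> carrier_vec n" "v \<bullet> v = 1" "A *\<^sub>v v = c \<cdot>\<^sub>v v"
proof -
  have "size (eigvals A) \<noteq> 0" using size_eigvals_symmetric[OF A sym] n by simp
  then obtain c where "c \<in># eigvals A" by (metis multiset_nonemptyE size_empty)
  moreover have "char_poly A \<noteq> 0" using degree_monic_char_poly[OF A] by auto
  ultimately have "poly (char_poly A) c = 0" by (simp add: eigvals_def)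
  then obtain w where w: "w \<in> carrier_vec n" "w \<noteq> 0\<^sub>v n" "A *\<^sub>v w = c \<cdot>\<^sub>v w"
    using A by (auto simp: eigenvalue_root_char_poly[OF A, symmetric] eigenvalue_def eigenvector_def)
  have "0 \<le> w \<bullet> w" by (simp add: scalar_prod_def sum_nonneg)
  moreover have "w \<bullet> w \<noteq> 0" using conjugate_square_eq_0_vec[OF w(1)] w(2) by simp
  ultimately have pos: "0 < w \<bullet> w" by simp
  define r where "r = 1 / sqrt (w \<bullet> w)"
  have r: "r * r * (w \<bullet> w) = 1" using pos by (simp add: r_def)
  show thesis
  proof (rule that)
    show "r \<cdot>\<^sub>v w \<in> carrier_vec n" using w by simp
    show "(r \<cdot>\<^sub>v w) \<bullet> (r \<cdot>\<^sub>v w) = 1" using w(1) r by (simp add: mult.assoc)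
    show "A *\<^sub>v (r \<cdot>\<^sub>v w) = c \<cdot>\<^sub>v (r \<cdot>\<^sub>v w)"
      using w A by (simp add: mult_mat_vec smult_smult_assoc mult.commute)
  qed
qed

text \<open>Deflation: a Householder reflection \<open>H\<close> sends e_0 to a unit eigenvector, so
  H A H has first column c e_0 and, by symmetry, first row c e_0^T. The induction hypothesis
  diagonalizes the remaining n x n block.\<close>

lemma symmetric_orthogonally_diagonalizable:
  fixes A :: "real mat"
  assumes "A \<in> carrier_mat n n" and "transpose_mat A = A"
  shows "\<exists>U D. U \<in> carrier_mat n n \<and> D \<in> carrier_mat n n \<and> transpose_mat U * U = 1\<^sub>m n \<and>
    diagonal_mat D \<and> A = U * D * transpose_mat U"
  using assms
proof (induction n arbitrary: A)
  case 0
  then show ?case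
    by (intro exI[of _ "1\<^sub>m 0"]) (auto simp: diagonal_mat_def)
next
  case (Suc n)
  note A = Suc.prems(1) and sym = Suc.prems(2)
  obtain v c where v: "v \<in> carrier_vec (Suc n)" "v \<bullet> v = 1" "A *\<^sub>v v = c \<cdot>\<^sub>v v"
    using symmetric_eigenvector_exists[OF A sym] by blast
  obtain H where H: "H \<in> carrier_mat (Suc n) (Suc n)" "transpose_mat H = H" "H * H = 1\<^sub>m (Suc n)"
    "col H 0 = v"
    using householder_unit_vec[OF v(1,2)] by blast
  define B where "B = H * A * H"
  have B: "B \<in> carrier_mat (Suc n) (Suc n)" using A H by (simp add: B_def)
  have symB: "transpose_mat B = B"
    using A H sym by (simp add: B_def transpose_mult[of _ "Suc n" "Suc n" _ "Suc n"]
        assoc_mult_mat[of _ "Suc n" "Suc n" _ "Suc n" _ "Suc n"])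
  have A_eq: "A = H * B * H"
  proof -
    have "H * B * H = (H * H) * A * (H * H)"
      using A H(1) by (simp add: B_def assoc_mult_mat[of _ "Suc n" "Suc n" _ "Suc n" _ "Suc n"]
          del: H)
    then show ?thesis using A by (simp add: H)
  qed
  \<comment> \<open>B e_0 = H A v = c H v, and H v = H (H e_0) = e_0 because \<open>H\<close> is an
    involution.\<close>
  have "col B 0 = (H * A) *\<^sub>v col H 0"
    unfolding B_def using A H(1) by (intro col_mult2[of _ "Suc n" "Suc n" _ "Suc n"]) auto
  also have "\<dots> = H *\<^sub>v (A *\<^sub>v v)"
    unfolding H(4) by (rule assoc_mult_mat_vec[OF H(1) A v(1)])
  also have "\<dots> = c \<cdot>\<^sub>v (H *\<^sub>v v)"
    unfolding v(3) using v(1) H(1) by (simp add: mult_mat_vec)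
  also have "H *\<^sub>v v = col (H * H) 0"
    unfolding H(4)[symmetric] using H(1) by (intro col_mult2[symmetric, of _ "Suc n" "Suc n" _ "Suc n"]) auto
  also have "\<dots> = unit_vec (Suc n) 0" by (simp add: H)
  finally have colB: "col B 0 = c \<cdot>\<^sub>v unit_vec (Suc n) 0" .
  have B0: "B $$ (i, 0) = (if i = 0 then c else 0)" if "i < Suc n" for i
    using arg_cong[OF colB, of "\<lambda>w. w $ i"] B that by simp
  have Bsym: "B $$ (i, j) = B $$ (j, i)" if "i < Suc n" "j < Suc n" for i j
    using arg_cong[OF symB, of "\<lambda>M. M $$ (i, j)"] B that by simp
  define A' where "A' = mat n n (\<lambda>(i, j). B $$ (Suc i, Suc j))"
  have A': "A' \<in> carrier_mat n n" by (simp add: A'_def)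
  have "transpose_mat A' = A'"
    by (intro eq_matI) (auto simp: A'_def Bsym)
  from Suc.IH[OF A' this] obtain U D where UD: "U \<in> carrier_mat n n" "D \<in> carrier_mat n n"
    "transpose_mat U * U = 1\<^sub>m n" "diagonal_mat D" "A' = U * D * transpose_mat U" by blast
  \<comment> \<open>Block diagonal matrices with a 1 x 1 corner multiply and transpose blockwise,
    which lifts the factorization of \<open>A'\<close> to one of \<open>B\<close>.\<close>
  let ?blk = "\<lambda>x M. four_block_mat (mat 1 1 (\<lambda>_. x)) (0\<^sub>m 1 n) (0\<^sub>m n 1) M :: real mat"
  have blk_mult: "?blk x M * ?blk y N = ?blk (x * y) (M * N)"
    if "M \<in> carrier_mat n n" "N \<in> carrier_mat n n" for x y M N
  proof -
    have "mat 1 1 (\<lambda>_. x) * mat 1 1 (\<lambda>_. y) = mat 1 1 (\<lambda>_. x * y)"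
      by (rule eq_matI) (auto simp: scalar_prod_def)
    then show ?thesis
      using that by (subst mult_four_block_mat[of _ 1 1 _ n _ n]) auto
  qed
  have blk_transpose: "transpose_mat (?blk x M) = ?blk x (transpose_mat M)"
    if "M \<in> carrier_mat n n" for x M
  proof -
    have "transpose_mat (mat 1 1 (\<lambda>_. x)) = mat 1 1 (\<lambda>_. x)" by (rule eq_matI) auto
    then show ?thesis
      using that by (subst transpose_four_block_mat[of _ 1 1 _ n _ n]) auto
  qed
  define W where "W = ?blk 1 U"
  define E where "E = ?blk c D"
  have W: "W \<in> carrier_mat (Suc n) (Suc n)" and E: "E \<in> carrier_mat (Suc n) (Suc n)"
    using UD by (auto simp: W_def E_def)
  have WE: "W * E = ?blk c (U * D)"
    using blk_mult[OF UD(1,2), of 1 c] by (simp only: W_def E_def mult_1)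
  have Wt: "transpose_mat W = ?blk 1 (transpose_mat U)"
    unfolding W_def by (rule blk_transpose[OF UD(1)])
  have "B = ?blk c A'"
  proof (rule eq_matI)
    fix i j assume "i < dim_row (?blk c A')" "j < dim_col (?blk c A')"
    then show "B $$ (i, j) = ?blk c A' $$ (i, j)"
      using B0 Bsym[of 0 j] by (cases i; cases j) (auto simp: A'_def)
  qed (use B in \<open>auto simp: A'_def\<close>)
  also have "\<dots> = W * E * transpose_mat W"
    unfolding WE Wt UD(5) using UD(1,2) by (subst blk_mult) auto
  finally have B_eq: "B = W * E * transpose_mat W" .
  have WW: "transpose_mat W * W = 1\<^sub>m (Suc n)"
  proof -
    have "?blk 1 (1\<^sub>m n) = 1\<^sub>m (Suc n)" by (rule eq_matI) auto
    moreover have "transpose_mat W * W = ?blk (1 * 1) (transpose_mat U * U)"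
      unfolding Wt unfolding W_def using UD(1) by (intro blk_mult) auto
    ultimately show ?thesis by (simp only: UD(3) mult_1)
  qed
  have "diagonal_mat E"
    using UD by (auto simp: E_def diagonal_mat_def)
  moreover have "transpose_mat (H * W) * (H * W) = 1\<^sub>m (Suc n)"
  proof -
    have "transpose_mat (H * W) * (H * W) = transpose_mat W * (H * H) * W"
      using H(1,2) W by (simp add: transpose_mult[of _ "Suc n" "Suc n" _ "Suc n"]
        assoc_mult_mat[of _ "Suc n" "Suc n" _ "Suc n" _ "Suc n"])
    then show ?thesis using W by (simp add: H(3) WW)
  qed
  moreover have "A = (H * W) * E * transpose_mat (H * W)"
    using H(1,2) W E by (simp add: A_eq B_eq transpose_mult[of _ "Suc n" "Suc n" _ "Suc n"]
        assoc_mult_mat[of _ "Suc n" "Suc n" _ "Suc n" _ "Suc n"])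
  ultimately show ?case using H(1) W E by (intro exI[of _ "H * W"] exI[of _ E]) auto
qed

section \<open>Quadratic forms in an eigenbasis and trace bounds for sums of absolute
  eigenvalues\<close>

lemma sum_swap_innermost:
  "(\<Sum>a\<in>A. \<Sum>b\<in>B. \<Sum>c\<in>C. f a b c) = (\<Sum>c\<in>C. \<Sum>a\<in>A. \<Sum>b\<in>B. f a b c)"
proof -
  have "(\<Sum>a\<in>A. \<Sum>b\<in>B. \<Sum>c\<in>C. f a b c) = (\<Sum>a\<in>A. \<Sum>c\<in>C. \<Sum>b\<in>B. f a b c)"
    by (intro sum.cong refl sum.swap)
  also have "\<dots> = (\<Sum>c\<in>C. \<Sum>a\<in>A. \<Sum>b\<in>B. f a b c)" by (rule sum.swap)
  finally show ?thesis .
qed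

text \<open>Entries and coordinates are plain functions, so that linear combinations of forms need
  no carrier conditions; only their values below \<open>n\<close> matter.\<close>

definition quad_form :: "nat \<Rightarrow> (nat \<Rightarrow> nat \<Rightarrow> real) \<Rightarrow> (nat \<Rightarrow> real) \<Rightarrow> real" where
  "quad_form n C x = (\<Sum>i<n. \<Sum>j<n. C i j * x i * x j)"

text \<open>Coordinate form of A = U D U^T: \<open>p j\<close> is column j of \<open>U\<close> and
  \<open>l j\<close> the matching diagonal entry of \<open>D\<close>. The second sum condition is U
  U^T = 1, which follows from U^T U = 1 as \<open>U\<close> is square; the last conjunct is the
  Rayleigh quotient of a unit eigenvector.\<close>

lemma symmetric_spectral_decomposition:
  fixes A :: "real mat"
  assumes A: "A \<in> carrier_mat n n" and sym: "transpose_mat A = A"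
  shows "\<exists>l p. eigvals A = image_mset l (mset_set {..<n}) \<and>
    (\<forall>j<n. (\<Sum>i<n. (p j i)\<^sup>2) = 1) \<and>
    (\<forall>i<n. \<forall>k<n. (\<Sum>j<n. p j i * p j k) = (if i = k then 1 else 0)) \<and>
    (\<forall>i<n. \<forall>k<n. A $$ (i, k) = (\<Sum>j<n. l j * p j i * p j k)) \<and>
    (\<forall>j<n. l j = quad_form n (\<lambda>i k. A $$ (i, k)) (p j))"
proof -
  obtain U D where U: "U \<in> carrier_mat n n" and D: "D \<in> carrier_mat n n"
    and UU: "transpose_mat U * U = 1\<^sub>m n" and diag: "diagonal_mat D"
    and AU: "A = U * D * transpose_mat U"
    using symmetric_orthogonally_diagonalizable[OF assms] by blast
  have UU': "U * transpose_mat U = 1\<^sub>m n"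
    by (rule mat_mult_left_right_inverse[OF _ U UU]) (use U in simp)
  define l where "l j = D $$ (j, j)" for j
  define p where "p j i = U $$ (i, j)" for i j
  have orth: "(\<Sum>i<n. p j i * p k i) = (if j = k then 1 else 0)" if "j < n" "k < n" for j k
    using arg_cong[OF UU, of "\<lambda>M. M $$ (j, k)"] U that
    by (simp add: p_def scalar_prod_def lessThan_atLeast0)
  have compl: "(\<Sum>j<n. p j i * p j k) = (if i = k then 1 else 0)" if "i < n" "k < n" for i k
    using arg_cong[OF UU', of "\<lambda>M. M $$ (i, k)"] U that
    by (simp add: p_def scalar_prod_def lessThan_atLeast0)
  have UD: "(U * D) $$ (i, j) = p j i * l j" if "i < n" "j < n" for i j
  proof -
    have "(U * D) $$ (i, j) = (\<Sum>k<n. U $$ (i, k) * D $$ (k, j))"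
      using U D that by (simp add: scalar_prod_def lessThan_atLeast0)
    also have "\<dots> = (\<Sum>k<n. if k = j then p j i * l j else 0)"
      using diag D that by (intro sum.cong) (auto simp: diagonal_mat_def p_def l_def)
    finally show ?thesis using that by simp
  qed
  have spec: "A $$ (i, i') = (\<Sum>j<n. l j * p j i * p j i')" if "i < n" "i' < n" for i i'
  proof -
    define M where "M = U * D"
    have "M \<in> carrier_mat n n" using U D by (simp add: M_def)
    then have "A $$ (i, i') = (\<Sum>j<n. M $$ (i, j) * U $$ (i', j))"
      unfolding AU M_def[symmetric] using U that by (simp add: scalar_prod_def lessThan_atLeast0)
    then have "A $$ (i, i') = (\<Sum>j<n. (U * D) $$ (i, j) * U $$ (i', j))" by (simp add: M_def)
    then show ?thesis using that by (simp add: UD p_def[symmetric] mult_ac)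
  qed
  have lj: "l k = quad_form n (\<lambda>i i'. A $$ (i, i')) (p k)" if k: "k < n" for k
  proof -
    have "quad_form n (\<lambda>i i'. A $$ (i, i')) (p k)
        = (\<Sum>i<n. \<Sum>i'<n. \<Sum>j<n. l j * (p j i * p k i) * (p j i' * p k i'))"
      unfolding quad_form_def by (intro sum.cong refl) (auto simp: spec sum_distrib_left sum_distrib_right mult_ac)
    also have "\<dots> = (\<Sum>j<n. \<Sum>i<n. \<Sum>i'<n. l j * (p j i * p k i) * (p j i' * p k i'))"
      by (rule sum_swap_innermost)
    also have "\<dots> = (\<Sum>j<n. l j * (\<Sum>i<n. p j i * p k i) * (\<Sum>i'<n. p j i' * p k i'))"
      by (simp only: mult.assoc sum_product) (simp only: sum_distrib_left)
    also have "\<dots> = (\<Sum>j<n. if j = k then l k else 0)"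
      using k by (intro sum.cong) (auto simp: orth)
    finally show ?thesis using k by simp
  qed
  have "similar_mat A D"
    using U D A UU UU' AU by (intro similar_matI[of A D U "transpose_mat U" n]) auto
  then have "char_poly A = char_poly D" by (rule char_poly_similar)
  also have "\<dots> = (\<Prod>a\<leftarrow>diag_mat D. [:- a, 1:])"
    using diag D by (intro char_poly_upper_triangular[OF D]) (auto simp: diagonal_mat_def)
  finally have "eigvals A = mset (diag_mat D)"
    unfolding eigvals_def by (simp only: proots_linear_factors)
  also have "diag_mat D = map l [0..<n]" using D by (simp add: diag_mat_def l_def)
  finally have "eigvals A = image_mset l (mset_set {..<n})"
    by (simp add: lessThan_atLeast0)
  moreover have "\<forall>j<n. (\<Sum>i<n. (p j i)\<^sup>2) = 1"
    by (simp add: orth power2_eq_square)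
  ultimately show ?thesis
    using compl spec lj by (intro exI[of _ l] exI[of _ p]) blast
qed

text \<open>Basis independence of the trace: tr (U^T C U) = tr (C U U^T) = tr C.\<close>

lemma sum_quad_form_complete:
  assumes "\<forall>i<n. \<forall>k<n. (\<Sum>j<n. p j i * p j k) = (if i = k then 1 else 0 :: real)"
  shows "(\<Sum>j<n. quad_form n C (p j)) = (\<Sum>i<n. C i i)"
proof -
  have "(\<Sum>j<n. quad_form n C (p j)) = (\<Sum>i<n. \<Sum>k<n. \<Sum>j<n. C i k * (p j i * p j k))"
    unfolding quad_form_def by (subst sum_swap_innermost[symmetric]) (simp add: mult.assoc)
  also have "\<dots> = (\<Sum>i<n. \<Sum>k<n. if k = i then C i i else 0)"
    by (intro sum.cong refl) (auto simp: sum_distrib_left[symmetric] assms)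
  finally show ?thesis by simp
qed

text \<open>The left side is tr ((A - c I) C). In the eigenbasis of \<open>A\<close> it becomes the
  sum of (l_j - c) q_C(p_j), and |q_C(p_j)| <= 1 because each p_j is a unit vector.\<close>

lemma sum_abs_shifted_eigvals_ge:
  fixes A :: "real mat"
  assumes A: "A \<in> carrier_mat n n" and sym: "transpose_mat A = A"
    and C: "\<And>x. \<bar>quad_form n C x\<bar> \<le> (\<Sum>i<n. (x i)\<^sup>2)"
  shows "(\<Sum>i<n. \<Sum>j<n. A $$ (i, j) * C i j) - c * (\<Sum>i<n. C i i)
    \<le> (\<Sum>l\<in>#eigvals A. \<bar>l - c\<bar>)"
proof -
  obtain l p where ev: "eigvals A = image_mset l (mset_set {..<n})"
    and norm: "\<forall>j<n. (\<Sum>i<n. (p j i)\<^sup>2) = 1"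
    and compl: "\<forall>i<n. \<forall>k<n. (\<Sum>j<n. p j i * p j k) = (if i = k then 1 else 0)"
    and spec: "\<forall>i<n. \<forall>k<n. A $$ (i, k) = (\<Sum>j<n. l j * p j i * p j k)"
    using symmetric_spectral_decomposition[OF A sym] by blast
  have "(\<Sum>i<n. \<Sum>k<n. A $$ (i, k) * C i k) = (\<Sum>i<n. \<Sum>k<n. \<Sum>j<n. l j * (C i k * p j i * p j k))"
    by (intro sum.cong refl) (auto simp: spec sum_distrib_left mult_ac)
  also have "\<dots> = (\<Sum>j<n. l j * quad_form n C (p j))"
    unfolding quad_form_def sum_distrib_left
    by (rule sum_swap_innermost)
  finally have "(\<Sum>i<n. \<Sum>k<n. A $$ (i, k) * C i k) - c * (\<Sum>i<n. C i i)
      = (\<Sum>j<n. (l j - c) * quad_form n C (p j))"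
    by (simp add: sum_quad_form_complete[OF compl, symmetric] sum_distrib_left sum_subtractf
        left_diff_distrib)
  also have "\<dots> \<le> (\<Sum>j<n. \<bar>l j - c\<bar>)"
  proof (rule sum_mono)
    fix j assume "j \<in> {..<n}"
    then have "\<bar>quad_form n C (p j)\<bar> \<le> 1" using C[of "p j"] norm by simp
    then have "\<bar>l j - c\<bar> * \<bar>quad_form n C (p j)\<bar> \<le> \<bar>l j - c\<bar>"
      by (intro mult_left_le) auto
    then show "(l j - c) * quad_form n C (p j) \<le> \<bar>l j - c\<bar>"
      by (simp flip: abs_mult)
  qed
  also have "\<dots> = (\<Sum>l\<in>#eigvals A. \<bar>l - c\<bar>)"
    by (simp add: ev image_mset.compositionality o_def sum_unfold_sum_mset)
  finally show ?thesis .
qed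

text \<open>Since l_j = q_A(p_j), each |l_j| is at most q_M(p_j), and these values add up to the
  trace of \<open>M\<close>.\<close>

lemma sum_abs_eigvals_le:
  fixes A :: "real mat"
  assumes A: "A \<in> carrier_mat n n" and sym: "transpose_mat A = A"
    and M: "\<And>x. \<bar>quad_form n (\<lambda>i j. A $$ (i, j)) x\<bar> \<le> quad_form n M x"
  shows "(\<Sum>l\<in>#eigvals A. \<bar>l\<bar>) \<le> (\<Sum>i<n. M i i)"
proof -
  obtain l p where ev: "eigvals A = image_mset l (mset_set {..<n})"
    and compl: "\<forall>i<n. \<forall>k<n. (\<Sum>j<n. p j i * p j k) = (if i = k then 1 else 0)"
    and quad: "\<forall>j<n. l j = quad_form n (\<lambda>i k. A $$ (i, k)) (p j)"
    using symmetric_spectral_decomposition[OF A sym] by blast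
  have "(\<Sum>l\<in>#eigvals A. \<bar>l\<bar>) = (\<Sum>j<n. \<bar>l j\<bar>)"
    by (simp add: ev image_mset.compositionality o_def sum_unfold_sum_mset)
  also have "\<dots> \<le> (\<Sum>j<n. quad_form n M (p j))"
    using M by (intro sum_mono) (auto simp: quad)
  finally show ?thesis by (simp add: sum_quad_form_complete[OF compl])
qed

section \<open>Quadratic forms of projections and of basic matrices\<close>

text \<open>With y = P x, symmetry and idempotence give |y|^2 = x . y = q_P(x). The bounds are then
  |y|^2 >= 0 and |x - y|^2 >= 0.\<close>

lemma quad_form_idempotent_bounds:
  assumes sym: "\<And>i j. i < n \<Longrightarrow> j < n \<Longrightarrow> P i j = P j i"
    and idem: "\<And>i j. i < n \<Longrightarrow> j < n \<Longrightarrow> (\<Sum>k<n. P i k * P k j) = P i j"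
  shows "0 \<le> quad_form n P x" "quad_form n P x \<le> (\<Sum>i<n. (x i)\<^sup>2)"
proof -
  define y where "y k = (\<Sum>i<n. P k i * x i)" for k
  have "(\<Sum>k<n. (y k)\<^sup>2) = (\<Sum>k<n. \<Sum>i<n. \<Sum>j<n. P i k * P k j * (x i * x j))"
    unfolding y_def power2_eq_square sum_product
    by (intro sum.cong refl) (auto simp: sym mult_ac)
  also have "\<dots> = (\<Sum>i<n. \<Sum>j<n. (\<Sum>k<n. P i k * P k j) * (x i * x j))"
    unfolding sum_distrib_right by (subst sum_swap_innermost[symmetric]) (rule refl)
  also have "\<dots> = quad_form n P x"
    unfolding quad_form_def by (intro sum.cong refl) (auto simp: idem)
  finally have y: "(\<Sum>k<n. (y k)\<^sup>2) = quad_form n P x" .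
  have "0 \<le> (\<Sum>k<n. (y k)\<^sup>2)" by (simp add: sum_nonneg)
  then show "0 \<le> quad_form n P x" by (simp add: y)
  have xy: "(\<Sum>k<n. x k * y k) = quad_form n P x"
    by (simp add: y_def quad_form_def sum_distrib_left mult_ac)
  have "0 \<le> (\<Sum>k<n. (x k - y k)\<^sup>2)" by (simp add: sum_nonneg)
  also have "\<dots> = (\<Sum>k<n. (x k)\<^sup>2) + (\<Sum>k<n. (y k)\<^sup>2) - 2 * (\<Sum>k<n. x k * y k)"
    by (simp add: power2_diff sum.distrib sum_subtractf sum_distrib_left mult.assoc)
  finally show "quad_form n P x \<le> (\<Sum>i<n. (x i)\<^sup>2)" by (simp add: xy y)
qed


lemma quad_form_linear:
  "quad_form n (\<lambda>i j. a * C i j + b * D i j) x = a * quad_form n C x + b * quad_form n D x"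
  by (simp add: quad_form_def sum_distrib_left sum.distrib algebra_simps)

lemma quad_form_identity:
  "quad_form n (\<lambda>i j. if i = j then 1 else 0) x = (\<Sum>i<n. (x i)\<^sup>2)"
proof -
  have "(\<Sum>j<n. (if i = j then 1 else 0) * x i * x j) = (x i)\<^sup>2" if "i < n" for i
  proof -
    have "(\<Sum>j<n. (if i = j then 1 else 0) * x i * x j) = (\<Sum>j<n. if i = j then (x i)\<^sup>2 else 0)"
      by (intro sum.cong) (auto simp: power2_eq_square)
    then show ?thesis using that by simp
  qed
  then show ?thesis by (simp add: quad_form_def)
qed

lemma quad_form_all_ones: "quad_form n (\<lambda>i j. 1) x = (\<Sum>i<n. x i)\<^sup>2"
  by (simp add: quad_form_def power2_eq_square sum_product)

lemma quad_form_cong: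
  assumes "\<And>i j. i < n \<Longrightarrow> j < n \<Longrightarrow> C i j = D i j"
  shows "quad_form n C x = quad_form n D x"
  unfolding quad_form_def using assms by (intro sum.cong) auto

section \<open>Partitions into classes of equal size and the two energy bounds\<close>

context
  fixes c :: "nat \<Rightarrow> 'b" and n m :: nat
  assumes class_card: "\<And>i. i < n \<Longrightarrow> card {j. j < n \<and> c j = c i} = m"
    and n_pos: "0 < n"
begin

text \<open>Averaging over the class minus averaging over all indices; this is the projection
  \<open>P\<close>. With a single class its entries at indices below \<open>n\<close>
  vanish.\<close>

definition class_proj :: "nat \<Rightarrow> nat \<Rightarrow> real" where
  "class_proj i j = (if c i = c j then 1 / m else 0) - 1 / n"

lemma class_size_bounds:
  "0 < m" "m \<le> n"
proof -
  have "0 < card {j. j < n \<and> c j = c 0}" using n_pos by (subst card_gt_0_iff) auto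
  then show "0 < m" using class_card[OF n_pos] by simp
  have "card {j. j < n \<and> c j = c 0} \<le> card {..<n}" by (intro card_mono) auto
  then show "m \<le> n" using class_card[OF n_pos] by simp
qed

lemma sum_over_class:
  assumes "i < n"
  shows "(\<Sum>k<n. if c k = c i then a else 0) = real m * a"
proof -
  have "(\<Sum>k<n. if c k = c i then a else 0) = (\<Sum>k\<in>{k \<in> {..<n}. c k = c i}. a)"
    by (rule sum.inter_filter[symmetric]) simp
  also have "{k \<in> {..<n}. c k = c i} = {k. k < n \<and> c k = c i}" by auto
  finally show ?thesis by (simp add: class_card[OF assms])
qed

text \<open>Write P = Q - R with Q the class average and R the global average. Then Q Q = Q and Q R
  = R Q = R R = R, so P P = Q - R - R + R; the four summands below are these four products.\<close>

lemma class_proj_idempotent: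
  assumes i: "i < n" and j: "j < n"
  shows "(\<Sum>k<n. class_proj i k * class_proj k j) = class_proj i j"
proof -
  have "(\<Sum>k<n. class_proj i k * class_proj k j) =
      (\<Sum>k<n. (if c k = c i then (if c i = c j then 1 / (real m * m) else 0) else 0)
        - (if c k = c i then 1 / (real m * n) else 0)
        - (if c k = c j then 1 / (real m * n) else 0) + 1 / (real n * n))"
    by (intro sum.cong) (auto simp: class_proj_def algebra_simps)
  also have "\<dots> = m * (if c i = c j then 1 / (real m * m) else 0) - m * (1 / (real m * n))
      - m * (1 / (real m * n)) + n * (1 / (real n * n))"
    by (simp only: sum.distrib sum_subtractf sum_over_class[OF i] sum_over_class[OF j]) simp
  also have "\<dots> = class_proj i j"
    using class_size_bounds n_pos by (auto simp: class_proj_def)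
  finally show ?thesis .
qed

lemma class_proj_bounds:
  "0 \<le> quad_form n class_proj x" "quad_form n class_proj x \<le> (\<Sum>i<n. (x i)\<^sup>2)"
proof -
  have sym: "class_proj i j = class_proj j i" for i j by (auto simp: class_proj_def)
  show "0 \<le> quad_form n class_proj x" "quad_form n class_proj x \<le> (\<Sum>i<n. (x i)\<^sup>2)"
    using quad_form_idempotent_bounds[OF sym class_proj_idempotent] by auto
qed

context
  fixes A :: "real mat"
  assumes A: "A \<in> carrier_mat n n"
    and A_entry: "\<And>i j. i < n \<Longrightarrow> j < n \<Longrightarrow> A $$ (i, j) = (if c i = c j then 0 else 1)"
begin

lemma transpose_multipartite_mat: "transpose_mat A = A"
  using A by (intro eq_matI) (auto simp: A_entry)

lemma sum_abs_eigvals_multipartite_le: "(\<Sum>l\<in>#eigvals A. \<bar>l\<bar>) \<le> 2 * (real n - real m)"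
proof -
  define a where "a = (real n - real m) / real n"
  have a: "0 \<le> a" using class_size_bounds by (simp add: a_def)
  \<comment> \<open>The right side is a - 1 + m/n = 0 within a class and a + m/n = 1 between
    classes, which fixes the choice of \<open>a\<close>.\<close>
  have "A $$ (i, j) = a * 1 + (- real m) * class_proj i j" if "i < n" "j < n" for i j
    using that class_size_bounds n_pos by (auto simp: A_entry a_def class_proj_def field_simps)
  then have quad_A: "quad_form n (\<lambda>i j. A $$ (i, j)) x = a * (\<Sum>i<n. x i)\<^sup>2 - m * quad_form n class_proj x" for x
    by (subst quad_form_cong[where D = "\<lambda>i j. a * 1 + (- real m) * class_proj i j"])
      (auto simp only: quad_form_linear quad_form_all_ones)
  let ?M = "\<lambda>i j. a * 1 + real m * class_proj i j"
  have "(\<Sum>l\<in>#eigvals A. \<bar>l\<bar>) \<le> (\<Sum>i<n. ?M i i)"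
  proof (rule sum_abs_eigvals_le[OF A transpose_multipartite_mat, where M = ?M])
    fix x :: "nat \<Rightarrow> real"
    have "0 \<le> a * (\<Sum>i<n. x i)\<^sup>2" "0 \<le> m * quad_form n class_proj x"
      using a class_proj_bounds by simp_all
    then show "\<bar>quad_form n (\<lambda>i j. A $$ (i, j)) x\<bar> \<le> quad_form n ?M x"
      unfolding quad_A quad_form_linear quad_form_all_ones by linarith
  qed
  \<comment> \<open>Each of the n diagonal entries is a + m (1/m - 1/n) = 2 (n - m)/n.\<close>
  also have "\<dots> = 2 * (real n - real m)"
    using class_size_bounds n_pos by (simp add: a_def class_proj_def field_simps)
  finally show ?thesis .
qed

text \<open>Subtracting the mean of \<open>L\<close> makes the diagonal perturbation traceless, and
  against the constant diagonal \<open>t\<close> of \<open>C\<close> it contributes nothing. The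
  reflection \<open>C\<close> is admissible because 0 <= q_P(x) <= |x|^2 gives |q_C(x)| <=
  |x|^2.\<close>

lemma sum_abs_shifted_eigvals_multipartite_ge:
  fixes L :: "nat \<Rightarrow> real"
  assumes B: "B = A + mat n n (\<lambda>(i, j). if i = j then L i else 0)"
  shows "2 * (real n - real m) \<le> (\<Sum>l\<in>#eigvals B. \<bar>l - (\<Sum>i<n. L i) / n\<bar>)"
proof -
  define C where "C i j = 1 * (if i = j then 1 else 0) + (- 2) * class_proj i j" for i j
  define t where "t = 1 - 2 / real m + 2 / real n"
  have C_diag: "C i i = t" for i by (simp add: C_def t_def class_proj_def)
  have B_carrier: "B \<in> carrier_mat n n" using A by (simp add: B)
  have B_sym: "transpose_mat B = B"
    using A by (intro eq_matI) (auto simp: B A_entry)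
  have "\<bar>quad_form n C x\<bar> \<le> (\<Sum>i<n. (x i)\<^sup>2)" for x
    using class_proj_bounds[of x]
    unfolding C_def quad_form_linear quad_form_identity by linarith
  note bound = sum_abs_shifted_eigvals_ge[OF B_carrier B_sym this]
  \<comment> \<open>Row i of \<open>A\<close> is 1 exactly at the n - m indices outside the class of
    i, where \<open>C\<close> has the entry 2/n; the diagonal adds L_i t.\<close>
  have row: "(\<Sum>j<n. B $$ (i, j) * C i j) = (real n - real m) * (2 / n) + L i * t" if i: "i < n" for i
  proof -
    have "(\<Sum>j<n. B $$ (i, j) * C i j)
        = (\<Sum>j<n. 2 / n - (if c j = c i then 2 / n else 0) + (if j = i then L i * t else 0))"
      using A i C_diag by (intro sum.cong) (auto simp: B A_entry C_def class_proj_def)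
    also have "\<dots> = n * (2 / n) - m * (2 / n) + L i * t"
      using i by (simp only: sum.distrib sum_subtractf sum_over_class[OF i]) simp
    finally show ?thesis using n_pos by (simp add: field_simps)
  qed
  \<comment> \<open>Summing the rows leaves t times the total of \<open>L\<close>, which the shift
    removes since tr C = n t.\<close>
  have "(\<Sum>i<n. \<Sum>j<n. B $$ (i, j) * C i j) - (\<Sum>i<n. L i) / n * (\<Sum>i<n. C i i)
      = 2 * (real n - real m)"
    using n_pos by (simp add: row sum.distrib C_diag sum_distrib_right[symmetric])
  with bound[of "(\<Sum>i<n. L i) / n"] show ?thesis by simp
qed

end

end

section \<open>From the graph to equal colour classes, and the conclusion\<close>

text \<open>The colour of a vertex is the index of the part containing its image under the
  isomorphism. A vertex is adjacent to everything outside its class, so a common degree d forces the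
  common class size |V| - d.\<close>

lemma regular_complete_multipartite_classes:
  assumes "complete_multipartite G" and "regular_graph G" and fin: "finite (pverts G)"
  shows "pverts G \<noteq> {}"
    and "\<exists>c m. (\<forall>u \<in> pverts G. \<forall>v \<in> pverts G. (u, v) \<in> parcs G \<longleftrightarrow> c u \<noteq> (c v :: nat)) \<and>
      (\<forall>v \<in> pverts G. card {u \<in> pverts G. c u = c v} = m)"
proof -
  let ?K = "complete_multipartite_graph"
  obtain ns f where ns: "ns \<noteq> []" "\<forall>m \<in> set ns. 0 < m"
    and f: "pre_digraph.digraph_isomorphism (with_proj G) f"
      "with_proj (?K ns) = app_iso f (with_proj G)"
    using assms(1) unfolding complete_multipartite_def digraph_iso_def by blast
  define h where "h = iso_verts f"
  have wf: "wf_digraph (with_proj G)" and inj: "inj_on h (pverts G)"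
    using f(1) by (auto simp: pre_digraph.digraph_isomorphism_def h_def)
  have verts: "pverts (?K ns) = h ` pverts G"
    using arg_cong[OF f(2), of verts] by (simp add: h_def)
  have arcs: "parcs (?K ns) = iso_arcs f ` parcs G"
    using arg_cong[OF f(2), of arcs] by simp
  \<comment> \<open>Both digraphs have the pair projections as tail and head, so the arc map is
    determined by the vertex map \<open>h\<close>.\<close>
  have ends: "iso_tail f = fst" "iso_head f = snd"
    using arg_cong[OF f(2), of tail] arg_cong[OF f(2), of head] by simp_all
  have iso_arc: "iso_arcs f (u, v) = (h u, h v)" if "(u, v) \<in> parcs G" for u v
    using f(1) that
    by (auto simp: pre_digraph.digraph_isomorphism_def ends h_def intro!: prod_eqI)
  have in_verts: "u \<in> pverts G" "v \<in> pverts G" if "(u, v) \<in> parcs G" for u v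
    using wf_digraph.tail_in_verts[OF wf, of "(u, v)"] wf_digraph.head_in_verts[OF wf, of "(u, v)"] that
    by simp_all
  have adj: "(u, v) \<in> parcs G \<longleftrightarrow> fst (h u) \<noteq> fst (h v)"
    if u: "u \<in> pverts G" and v: "v \<in> pverts G" for u v
  proof -
    have "(u, v) \<in> parcs G \<longleftrightarrow> (h u, h v) \<in> parcs (?K ns)"
    proof
      assume "(u, v) \<in> parcs G"
      then show "(h u, h v) \<in> parcs (?K ns)" unfolding arcs by (metis iso_arc imageI)
    next
      \<comment> \<open>The preimage arc may a priori have other endpoints; injectivity of
        \<open>h\<close> identifies them with u and v.\<close>
      assume "(h u, h v) \<in> parcs (?K ns)"
      then obtain u' v' where e: "(u', v') \<in> parcs G" "iso_arcs f (u', v') = (h u, h v)"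
        unfolding arcs by auto
      then have "h u' = h u" "h v' = h v" using iso_arc by auto
      then show "(u, v) \<in> parcs G" using e(1) in_verts[OF e(1)] inj u v by (metis inj_onD)
    qed
    moreover have "h u \<in> pverts (?K ns)" "h v \<in> pverts (?K ns)" using u v verts by auto
    ultimately show ?thesis by (auto simp: complete_multipartite_graph_simps)
  qed
  obtain d where d: "out_degree (with_proj G) v = d" if "v \<in> pverts G" for v
    using assms(2) by (auto simp: regular_graph_def)
  \<comment> \<open>Truncated subtraction is harmless, as d counts the vertices outside the class of
    v.\<close>
  have card_class: "card {u \<in> pverts G. fst (h u) = fst (h v)} = card (pverts G) - d" if v: "v \<in> pverts G" for v
  proof -
    have "out_arcs (with_proj G) v = Pair v ` {u \<in> pverts G. fst (h u) \<noteq> fst (h v)}"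
    proof (intro subset_antisym subsetI)
      fix e assume "e \<in> out_arcs (with_proj G) v"
      then have e: "(v, snd e) \<in> parcs G" "e = (v, snd e)" by (auto simp: out_arcs_def)
      then have "snd e \<in> pverts G" by (intro in_verts)
      with e adj[OF v this] show "e \<in> Pair v ` {u \<in> pverts G. fst (h u) \<noteq> fst (h v)}"
        by (intro image_eqI[of _ _ "snd e"]) simp_all
    next
      fix e assume "e \<in> Pair v ` {u \<in> pverts G. fst (h u) \<noteq> fst (h v)}"
      then obtain u where "e = (v, u)" "u \<in> pverts G" "fst (h u) \<noteq> fst (h v)" by auto
      with adj[OF v, of u] show "e \<in> out_arcs (with_proj G) v" by (simp add: out_arcs_def)
    qed
    then have "d = card {u \<in> pverts G. fst (h u) \<noteq> fst (h v)}"
      using d[OF v] by (simp add: out_degree_def card_image inj_on_def)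
    moreover have "card (pverts G) = card {u \<in> pverts G. fst (h u) = fst (h v)}
        + card {u \<in> pverts G. fst (h u) \<noteq> fst (h v)}"
      using fin by (subst card_Un_disjoint[symmetric]) (auto intro!: arg_cong[of _ _ card])
    ultimately show ?thesis by simp
  qed
  show "\<exists>c m. (\<forall>u \<in> pverts G. \<forall>v \<in> pverts G. (u, v) \<in> parcs G \<longleftrightarrow> c u \<noteq> (c v :: nat)) \<and>
      (\<forall>v \<in> pverts G. card {u \<in> pverts G. c u = c v} = m)"
    by (intro exI[of _ "\<lambda>v. fst (h v)"] exI[of _ "card (pverts G) - d"] conjI ballI adj card_class)
  show "pverts G \<noteq> {}"
  proof -
    have "(0, 0) \<in> pverts (?K ns)"
      using ns by (cases ns) (auto simp: complete_multipartite_graph_simps)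
    then show ?thesis using verts by auto
  qed
qed

theorem corollary3p9:
  fixes G :: "'a pair_pre_digraph" and S :: "'a set"
  assumes "pair_graph G"
    and "complete_multipartite G"
    and "regular_graph G"
    and "S \<subseteq> pverts G"
  shows "self_loop_energy G S \<ge> energy G"
proof -
  interpret pair_graph G by fact
  define vs where "vs = vertex_list G"
  define n where "n = length vs"
  have vs: "distinct vs" "set vs = pverts G"
    using vertex_list[OF pair_finite_verts] by (simp_all add: vs_def)
  have bij: "bij_betw ((!) vs) {..<n} (pverts G)"
    using bij_betw_nth[OF vs(1)] vs(2) by (simp add: n_def)
  \<comment> \<open>Transfers counts from vertices to matrix indices, both for the class sizes and
    for the number of loops.\<close>
  have card_vert: "card {i. i < n \<and> Q (vs ! i)} = card {v \<in> pverts G. Q v}" for Q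
  proof -
    have "(!) vs ` {i. i < n \<and> Q (vs ! i)} = {v \<in> pverts G. Q v}"
      using bij_betw_imp_surj_on[OF bij, symmetric] by auto
    moreover have "inj_on ((!) vs) {i. i < n \<and> Q (vs ! i)}"
      by (rule inj_on_subset[OF bij_betw_imp_inj_on[OF bij]]) auto
    ultimately show ?thesis by (metis card_image)
  qed
  have nth: "vs ! i \<in> pverts G" if "i < n" for i
    using nth_mem[of i vs] that by (simp add: n_def vs(2))
  note ne = regular_complete_multipartite_classes(1)[OF assms(2,3) pair_finite_verts]
  obtain c :: "'a \<Rightarrow> nat" and m
    where adj: "\<forall>u \<in> pverts G. \<forall>v \<in> pverts G. (u, v) \<in> parcs G \<longleftrightarrow> c u \<noteq> c v"
      and part: "\<forall>v \<in> pverts G. card {u \<in> pverts G. c u = c v} = m"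
    using regular_complete_multipartite_classes(2)[OF assms(2,3) pair_finite_verts]
    by (elim exE conjE) (rule that)
  let ?c = "\<lambda>i. c (vs ! i)"
  have class': "card {j. j < n \<and> ?c j = ?c i} = m" if "i < n" for i
    using card_vert[of "\<lambda>v. c v = ?c i"] part nth[OF that] by simp
  have n: "card (pverts G) = n" "0 < n"
    using distinct_card[OF vs(1)] vs(2) ne by (auto simp: n_def)
  have carrier: "adjacency_mat G \<in> carrier_mat n n"
    by (simp add: adjacency_mat_def adj_mat_wrt_def vs_def n_def)
  have entry: "adjacency_mat G $$ (i, j) = (if ?c i = ?c j then 0 else 1)" if "i < n" "j < n" for i j
    using that adj nth by (simp add: adjacency_mat_def adj_mat_wrt_def vs_def n_def)
  \<comment> \<open>The loop indicator sums to |S|, so the shift in the energy is exactly the mean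
    of \<open>?L\<close>.\<close>
  let ?L = "\<lambda>i. if vs ! i \<in> S then 1 else 0 :: real"
  have "(\<Sum>i<n. ?L i) = real (card {i. i < n \<and> vs ! i \<in> S})"
    by (subst sum.inter_filter[symmetric]) (simp_all add: Collect_conj_eq[symmetric])
  also have "\<dots> = real (card S)"
    using assms(4) card_vert[of "\<lambda>v. v \<in> S"] by (simp add: Collect_conj_eq Int_absorb1)
  finally have sigma: "(\<Sum>i<n. ?L i) = real (card S)" .
  have loops: "self_loop_adjacency_mat G S
      = adjacency_mat G + mat n n (\<lambda>(i, j). if i = j then ?L i else 0)"
    by (rule eq_matI) (auto simp: self_loop_adjacency_mat_def adjacency_mat_def adj_mat_wrt_def
        loop_mat_wrt_def vs_def n_def)
  have "energy G \<le> 2 * (real n - real m)"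
    unfolding energy_def
    by (rule sum_abs_eigvals_multipartite_le[OF class' n(2) carrier entry])
  also have "\<dots> \<le> self_loop_energy G S"
    unfolding self_loop_energy_def n sigma[symmetric]
    by (rule sum_abs_shifted_eigvals_multipartite_ge[OF class' n(2) carrier entry loops])
  finally show ?thesis .
qed

end
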